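(* Given arbitrary $\hat\alpha,\hat\beta,\hat\gamma,s_0\in\mathbb{D}^*$ and $s_1\in\mathbb{D}$, define a sequence of dual numbers $(s_j)_{j\ge0}$ by the recursion $$s_j=\hat\alpha\, s_{j-2}+\hat\beta\sum_{i=0}^{j-2}s_is_{j-2-i}+\hat\gamma\sum_{i=0}^{j-3}s_is_{j-3-i},\qquad j\ge2,$$ and form the associated sequence of Hankel determinants $$\Delta_n=\det(s_{i+j-2})_{i,j=1,\dots,n},\qquad n\ge1,$$ with $\Delta_0=1$. Then $$X_n=\Delta_{n-1},\qquad n\ge1,$$ is a solution of the dual Somos-4 recurrence $$X_{n+4}X_n=\alpha\,X_{n+3}X_{n+1}+\beta\,X_{n+2}^2\qquad(n\geq1)$$ with coefficients given by $$\alpha=U^2,\qquad \beta=\alpha F+\tfrac14J^2,$$ where $$U=-s_0\hat\gamma-s_1\hat\beta,\qquad F=-\hat\alpha-2s_0\hat\beta,$$ and the value of the first integral is fixed to be $$J=2\big(s_0\hat\alpha\hat\beta+s_0^2\hat\beta^2+s_1\hat\gamma\big).$$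
   Context: $\mathbb{D}=\{x+y\varepsilon : x,y\in\mathbb{C},\ \varepsilon^2=0\}$ is the commutative $\mathbb{C}$-algebra of dual numbers, with group of units $\mathbb{D}^*=\{x+y\varepsilon: x\ne0\}$. Empty sums are zero (so the last sum vanishes for $j=2$). The first integral of the dual Somos-4 recurrence is $$J=\frac{X_n^2X_{n+3}^2+\alpha\,(X_{n+1}^3X_{n+3}+X_nX_{n+2}^3)+\beta\,X_{n+1}^2X_{n+2}^2}{X_nX_{n+1}X_{n+2}X_{n+3}},$$ which is independent of $n$; the statement about its value means that this holds (in the form with denominators cleared) for the sequence $X_n$ with the stated value of $J$. *)

theory Defs
  imports Complex_Main "Jordan_Normal_Form.Determinant"
begin

(* Dual x y stands for x + y * eps with eps^2 = 0. *)
datatype dual = Dual (body: complex) (soul: complex)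

instantiation dual :: comm_ring_1
begin

definition zero_dual :: dual where "0 = Dual 0 0"

definition one_dual :: dual where "1 = Dual 1 0"

definition plus_dual :: "dual \<Rightarrow> dual \<Rightarrow> dual" where
  "a + b = Dual (body a + body b) (soul a + soul b)"

definition uminus_dual :: "dual \<Rightarrow> dual" where
  "- a = Dual (- body a) (- soul a)"

definition minus_dual :: "dual \<Rightarrow> dual \<Rightarrow> dual" where
  "a - b = Dual (body a - body b) (soul a - soul b)"

definition times_dual :: "dual \<Rightarrow> dual \<Rightarrow> dual" where
  "a * b = Dual (body a * body b) (body a * soul b + soul a * body b)"

instance
  by standard
    (auto simp: zero_dual_def one_dual_def plus_dual_def uminus_dual_def
      minus_dual_def times_dual_def algebra_simps)

end

definition eps :: dual where "eps = Dual 0 1"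

(* The structure map of dual as an algebra over the complex numbers. *)
definition dual_of_complex :: "complex \<Rightarrow> dual" where
  "dual_of_complex x = Dual x 0"

lemma eps_squared: "eps\<^sup>2 = 0"
  by (simp add: eps_def power2_eq_square times_dual_def zero_dual_def)

lemma Dual_eq: "Dual x y = dual_of_complex x + dual_of_complex y * eps"
  by (simp add: eps_def dual_of_complex_def plus_dual_def times_dual_def)

lemma dual_of_complex_hom:
  "dual_of_complex 1 = 1"
  "dual_of_complex (x + y) = dual_of_complex x + dual_of_complex y"
  "dual_of_complex (x * y) = dual_of_complex x * dual_of_complex y"
  by (simp_all add: dual_of_complex_def one_dual_def plus_dual_def times_dual_def)

definition dual_units :: "dual set" where
  "dual_units = {a. body a \<noteq> 0}"

lemma dual_units_iff: "a \<in> dual_units \<longleftrightarrow> a dvd 1"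
proof
  assume "a \<in> dual_units"
  then have "1 = a * Dual (1 / body a) (- soul a / (body a)\<^sup>2)"
    by (simp add: dual_units_def one_dual_def times_dual_def field_simps power2_eq_square)
  then show "a dvd 1" by (rule dvdI)
next
  assume "a dvd 1"
  then show "a \<in> dual_units"
    by (auto simp: dual_units_def one_dual_def times_dual_def elim!: dvdE)
qed

(* Matrix entries are indexed from 0 here, so the (i, j) entry is s (i + j);
   the 0 by 0 determinant is 1. *)
definition hankel_det :: "(nat \<Rightarrow> 'a::comm_ring_1) \<Rightarrow> nat \<Rightarrow> 'a" where
  "hankel_det s n = det (mat n n (\<lambda>(i, j). s (i + j)))"

lemma hankel_det_0: "hankel_det s 0 = 1"
  by (simp add: hankel_det_def det_dim_zero)

end

theory Submission
  imports Defs "HOL-Computational_Algebra.Formal_Power_Series"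
begin

text \<open>
  The recursion says that the generating function \<open>G\<close> of \<open>s\<close> is a root of a quadratic equation, and
  this persists along its continued fraction \<open>G\<^sub>k = u\<^sub>k / (1 - c\<^sub>k x - x\<^sup>2 G\<^sub>k\<^sub>+\<^sub>1)\<close>. Comparing coefficients
  of these equations gives, for suitable constants \<open>K\<close>, \<open>M\<close>, \<open>L\<close>, the relations
  \<open>u\<^sub>k (c\<^sub>k + c\<^sub>k\<^sub>-\<^sub>1) = K\<close>, \<open>u\<^sub>k + u\<^sub>k\<^sub>+\<^sub>1 + c\<^sub>k\<^sup>2 = M\<close> and \<open>u\<^sub>k u\<^sub>k\<^sub>+\<^sub>1 + K c\<^sub>k = L\<close>. Since
  \<open>u\<^sub>n\<^sub>+\<^sub>1 = \<Delta>\<^sub>n\<^sub>+\<^sub>2 \<Delta>\<^sub>n / \<Delta>\<^sub>n\<^sub>+\<^sub>1\<^sup>2\<close>, eliminating \<open>c\<close> yields the Somos-4 recurrence and its first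
  integral, provided that no Hankel determinant vanishes.

  That proviso is removed by lifting the five parameters along \<open>x \<mapsto> \<epsilon>\<close> to complex polynomials in
  \<open>x\<close> whose values at \<open>x = 1\<close> are the parameters of the aerated Catalan numbers, all of whose Hankel
  determinants are 1. The lifted determinants are then nonzero, so the identities hold in the fraction
  field of the polynomial ring, and they descend to the dual numbers.
\<close>

section \<open>Hankel determinants and continued fractions\<close>

text \<open>With \<open>D\<close> and \<open>G\<close> the generating functions of \<open>d\<close>
  and \<open>s\<close>, so that \<open>G D = u\<close>, multiplying
  \<open>(x G(x) - y G(y)) / (x - y)\<close> by \<open>D(x) D(y)\<close> gives
  \<open>u (x D(y) - y D(x)) / (x - y)\<close>, whose coefficients are the right-hand side. The
  induction moves one index from \<open>j\<close> to \<open>i\<close>, up to boundary terms.\<close>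

lemma toeplitz_hankel_toeplitz:
  fixes d s :: "nat \<Rightarrow> 'a::idom"
  assumes d0: "d 0 = 1"
    and conv: "\<And>m. (\<Sum>k\<le>m. d (m - k) * s k) = (if m = 0 then u else 0)"
  shows "(\<Sum>l\<le>j. (\<Sum>k\<le>i. d (i - k) * s (k + l)) * d (j - l)) =
    (if i = 0 \<and> j = 0 then u else if i = 0 \<or> j = 0 then 0 else - u * d (i + j))"
proof (induction i arbitrary: j)
  case 0
  have "(\<Sum>l\<le>j. s l * d (j - l)) = (if j = 0 then u else 0)"
    using conv[of j] by (simp add: mult.commute)
  then show ?case by (simp add: d0)
next
  case (Suc i)
  define R where "R i l = (\<Sum>k\<le>i. d (i - k) * s (k + l))" for i l
  have R_Suc: "R (Suc i) l = R i (Suc l) + d (Suc i) * s l" for l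
    unfolding R_def by (subst sum.atMost_Suc_shift) simp
  have R0: "R i 0 = (if i = 0 then u else 0)"
    using conv[of i] by (simp add: R_def)
  have "(\<Sum>l\<le>j. R (Suc i) l * d (j - l))
      = (\<Sum>l\<le>j. R i (Suc l) * d (j - l)) + d (Suc i) * (\<Sum>l\<le>j. d (j - l) * s l)"
    by (simp add: R_Suc sum.distrib algebra_simps sum_distrib_left)
  also have "(\<Sum>l\<le>j. R i (Suc l) * d (j - l)) = (\<Sum>l\<le>Suc j. R i l * d (Suc j - l)) - R i 0 * d (Suc j)"
    by (subst sum.atMost_Suc_shift) simp
  finally have step: "(\<Sum>l\<le>j. R (Suc i) l * d (j - l))
      = (\<Sum>l\<le>Suc j. R i l * d (Suc j - l)) - R i 0 * d (Suc j)
        + d (Suc i) * (if j = 0 then u else 0)"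
    by (simp only: conv)
  show ?case
    using step Suc.IH[of "Suc j"] by (auto simp: R0 R_def[symmetric] simp del: sum.atMost_Suc)
qed

text \<open>
  The Hankel matrix of \<open>G\<close> becomes block diagonal under congruence by the unipotent Toeplitz matrix
  of \<open>u / G\<close>.
\<close>
lemma hankel_det_cfrac_step:
  fixes G H :: "'a::idom fps"
  assumes G: "G * (1 - fps_const c * fps_X - fps_X\<^sup>2 * H) = fps_const u"
  shows "hankel_det (fps_nth G) (Suc n) = u ^ Suc n * hankel_det (fps_nth H) n"
proof -
  let ?N = "Suc n"
  define D where "D = 1 - fps_const c * fps_X - fps_X\<^sup>2 * H"
  define d s where "d = fps_nth D" and "s = fps_nth G"
  have d0: "d 0 = 1"
    by (simp add: d_def D_def)
  have dh: "d (Suc (Suc m)) = - fps_nth H m" for m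
    by (simp add: d_def D_def fps_X_power_mult_nth)
  have conv: "(\<Sum>k\<le>m. d (m - k) * s k) = (if m = 0 then u else 0)" for m
  proof -
    have "(\<Sum>k\<le>m. d (m - k) * s k) = fps_nth (G * D) m"
      unfolding fps_mult_nth d_def s_def atMost_atLeast0 by (simp only: mult.commute)
    then show ?thesis
      using G by (simp add: D_def)
  qed
  define T where "T = mat ?N ?N (\<lambda>(i, k). if k \<le> i then d (i - k) else 0)"
  define K where "K = mat ?N ?N (\<lambda>(i, j). s (i + j))"
  have carr: "T \<in> carrier_mat ?N ?N" "K \<in> carrier_mat ?N ?N" "transpose_mat T \<in> carrier_mat ?N ?N"
    by (simp_all add: T_def K_def)
  have T_nth: "T $$ (i, k) = (if k \<le> i then d (i - k) else 0)" if "i < ?N" "k < ?N" for i k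
    using that by (simp add: T_def)
  have detT: "det T = 1"
    by (subst det_lower_triangular[of ?N])
      (auto simp: T_def d0 prod_list_diag_prod)
  have mult_nth: "(A * B) $$ (i, j) = (\<Sum>k<?N. A $$ (i, k) * B $$ (k, j))"
    if "A \<in> carrier_mat ?N ?N" "B \<in> carrier_mat ?N ?N" "i < ?N" "j < ?N" for A B :: "'a mat" and i j
    using that by (simp add: scalar_prod_def lessThan_atLeast0 del: sum.op_ivl_Suc)
  have TK: "(T * K) $$ (i, l) = (\<Sum>k\<le>i. d (i - k) * s (k + l))"
    if "i < ?N" "l < ?N" for i l
  proof -
    have "(T * K) $$ (i, l) = (\<Sum>k<?N. T $$ (i, k) * K $$ (k, l))"
      using that carr by (intro mult_nth)
    also have "\<dots> = (\<Sum>k\<le>i. d (i - k) * s (k + l))"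
      using that by (intro sum.mono_neutral_cong_right) (auto simp: T_def K_def)
    finally show ?thesis .
  qed
  \<comment> \<open>Row and column 0 decouple. By \<open>dh\<close> the entries
    \<open>- u * d (i + j)\<close> with \<open>i, j > 0\<close> form \<open>u\<close> times the
    Hankel matrix of \<open>H\<close>, both indices being shifted by one.\<close>
  have "T * K * transpose_mat T = four_block_mat (mat 1 1 (\<lambda>_. u)) (0\<^sub>m 1 n) (0\<^sub>m n 1)
    (u \<cdot>\<^sub>m mat n n (\<lambda>(i, j). fps_nth H (i + j)))" (is "_ = ?B")
  proof (rule eq_matI)
    fix i j assume "i < dim_row ?B" "j < dim_col ?B"
    then have ij: "i < ?N" "j < ?N" by simp_all
    have "(T * K * transpose_mat T) $$ (i, j) = (\<Sum>l<?N. (T * K) $$ (i, l) * T $$ (j, l))"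
      using ij carr by (subst mult_nth) (auto simp del: sum.lessThan_Suc intro: mult_carrier_mat)
    also have "\<dots> = (\<Sum>l\<le>j. (\<Sum>k\<le>i. d (i - k) * s (k + l)) * d (j - l))"
      using ij by (intro sum.mono_neutral_cong_right) (auto simp: TK T_nth)
    also have "\<dots> = ?B $$ (i, j)"
      using ij by (subst toeplitz_hankel_toeplitz[OF d0 conv])
        (auto simp: dh gr0_conv_Suc)
    finally show "(T * K * transpose_mat T) $$ (i, j) = ?B $$ (i, j)" .
  qed (use carr in auto)
  moreover have "det (T * K * transpose_mat T) = det K"
    using carr by (simp add: det_mult[of _ ?N] det_transpose[of _ ?N] detT)
  moreover have "det ?B = u * (u ^ n * hankel_det (fps_nth H) n)"
    by (subst det_four_block_mat_upper_right_zero[of _ 1 _ n])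
      (auto simp: hankel_det_def det_single)
  ultimately show ?thesis
    by (simp add: hankel_det_def K_def s_def)
qed

section \<open>Continued fractions of quadratic power series\<close>

text \<open>Solves \<open>G = u / (1 - c x - x^2 H)\<close> for \<open>H\<close>, where
  \<open>u\<close> and \<open>u c\<close> are the first two coefficients of
  \<open>G\<close>.\<close>

definition cfrac_tail :: "'a::field fps \<Rightarrow> 'a fps" where
  "cfrac_tail G = fps_shift 2 (1 - fps_const (fps_nth G 1 / fps_nth G 0) * fps_X
     - fps_const (fps_nth G 0) * inverse G)"

lemma cfrac_tail:
  assumes "fps_nth G 0 \<noteq> 0"
  shows "G * (1 - fps_const (fps_nth G 1 / fps_nth G 0) * fps_X - fps_X\<^sup>2 * cfrac_tail G)
    = fps_const (fps_nth G 0)"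
proof -
  define E where "E = 1 - fps_const (fps_nth G 1 / fps_nth G 0) * fps_X
     - fps_const (fps_nth G 0) * inverse G"
  have inv: "inverse G * G = 1"
    using assms by (rule inverse_mult_eq_1)
  have "fps_nth (inverse G * G) 1 = 0"
    by (simp add: inv)
  then have inv1: "fps_nth (inverse G) 1 = - fps_nth G 1 / (fps_nth G 0)\<^sup>2"
    using assms by (simp add: fps_mult_nth field_simps power2_eq_square eq_neg_iff_add_eq_0)
  \<comment> \<open>This choice of \<open>c\<close> cancels the linear coefficient, so the shift by
    2 is exact division by \<open>fps_X\<^sup>2\<close>.\<close>
  have "fps_nth E 0 = 0" "fps_nth E 1 = 0"
    using assms inv1 by (simp_all add: E_def power2_eq_square)
  then have "fps_nth E n = 0" if "n < 2" for n
    using that by (auto simp: less_2_cases_iff)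
  then have tail: "fps_X\<^sup>2 * cfrac_tail G = E"
    unfolding cfrac_tail_def E_def[symmetric]
    by (intro fps_ext) (simp add: fps_X_power_mult_nth del: add_2_eq_Suc')
  have "G * (1 - fps_const (fps_nth G 1 / fps_nth G 0) * fps_X - fps_X\<^sup>2 * cfrac_tail G)
    = fps_const (fps_nth G 0) * (inverse G * G)"
    unfolding tail E_def by (simp add: algebra_simps)
  then show ?thesis
    by (simp add: inv)
qed

text \<open>A shape of quadratic equation that is stable under \<open>cfrac_tail\<close>. Its
  constant part carries the first two coefficients of \<open>G\<close>.\<close>

definition quadratic_fps :: "'a::comm_ring_1 \<Rightarrow> 'a \<Rightarrow> 'a \<Rightarrow> 'a \<Rightarrow> 'a \<Rightarrow> 'a fps \<Rightarrow> bool" where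
  "quadratic_fps e d q u v G \<longleftrightarrow>
     fps_X\<^sup>2 * (fps_const e + fps_const d * fps_X) * G\<^sup>2
     - (1 + fps_const q * fps_X\<^sup>2) * G + (fps_const u + fps_const v * fps_X) = 0"

lemma quadratic_fps_nth:
  assumes "quadratic_fps e d q u v G"
  shows "fps_nth G 0 = u" "fps_nth G 1 = v"
proof -
  have G: "G = fps_const u + fps_const v * fps_X
      + fps_X\<^sup>2 * ((fps_const e + fps_const d * fps_X) * G\<^sup>2 - fps_const q * G)"
    using assms by (simp add: quadratic_fps_def algebra_simps)
  show "fps_nth G 0 = u" "fps_nth G 1 = v"
    by (subst G; simp add: fps_X_power_mult_nth)+
qed

text \<open>Multiply the equation of \<open>G\<close> by the square of \<open>D = u / G\<close>,
  then cancel \<open>u * X\<^sup>2\<close>.\<close>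

lemma quadratic_cfrac_step:
  fixes G H X u c e d q :: "'a::idom"
  assumes "X \<noteq> 0" "u \<noteq> 0"
    and "X\<^sup>2 * (e + d * X) * G\<^sup>2 - (1 + q * X\<^sup>2) * G + (u + u * c * X) = 0"
    and "G * (1 - c * X - X\<^sup>2 * H) = u"
  shows "X\<^sup>2 * (1 + c * X) * H\<^sup>2 - (1 + (- 2 * c\<^sup>2 - q) * X\<^sup>2) * H
    + ((u * e - (c\<^sup>2 + q)) + (u * d + (c\<^sup>2 + q) * c) * X) = 0" (is "?r = 0")
proof -
  define D where "D = 1 - c * X - X\<^sup>2 * H"
  have GD: "G * D = u" using assms(4) by (simp add: D_def)
  have "(X\<^sup>2 * (e + d * X) * G\<^sup>2 - (1 + q * X\<^sup>2) * G + (u + u * c * X)) * D\<^sup>2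
    = X\<^sup>2 * (e + d * X) * (G * D)\<^sup>2 - (1 + q * X\<^sup>2) * (G * D) * D + u * (1 + c * X) * D\<^sup>2"
    by (simp add: algebra_simps power2_eq_square)
  also have "\<dots> = u * (X\<^sup>2 * (e + d * X) * u - (1 + q * X\<^sup>2) * D + (1 + c * X) * D\<^sup>2)"
    unfolding GD by (simp add: algebra_simps power2_eq_square)
  \<comment> \<open>The factor \<open>X\<^sup>2\<close> appears because
    \<open>(1 + c * X) * D\<close> is 1 modulo \<open>X\<^sup>2\<close>.\<close>
  also have "\<dots> = u * (X\<^sup>2 * ?r)"
    unfolding D_def by (simp add: algebra_simps power2_eq_square)
  finally show ?thesis
    using assms(1-3) by simp
qed

lemma quadratic_fps_cfrac_tail:
  fixes G :: "'a::field fps"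
  assumes G: "quadratic_fps e d q u v G" and u: "u \<noteq> 0" and c: "c = v / u"
  shows "quadratic_fps 1 c (- 2 * c\<^sup>2 - q) (u * e - (c\<^sup>2 + q)) (u * d + (c\<^sup>2 + q) * c) (cfrac_tail G)"
proof -
  note nth = quadratic_fps_nth[OF G]
  have v: "v = u * c" using u c by simp
  have "fps_X\<^sup>2 * (1 + fps_const c * fps_X) * (cfrac_tail G)\<^sup>2
    - (1 + (- 2 * (fps_const c)\<^sup>2 - fps_const q) * fps_X\<^sup>2) * cfrac_tail G
    + ((fps_const u * fps_const e - ((fps_const c)\<^sup>2 + fps_const q))
       + (fps_const u * fps_const d + ((fps_const c)\<^sup>2 + fps_const q) * fps_const c) * fps_X) = 0"
  proof (rule quadratic_cfrac_step)
    show "fps_X\<^sup>2 * (fps_const e + fps_const d * fps_X) * G\<^sup>2 - (1 + fps_const q * fps_X\<^sup>2) * G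
      + (fps_const u + fps_const u * fps_const c * fps_X) = 0"
      using G by (simp add: quadratic_fps_def v)
    show "G * (1 - fps_const c * fps_X - fps_X\<^sup>2 * cfrac_tail G) = fps_const u"
      using cfrac_tail[of G] u c by (simp add: nth del: One_nat_def)
  qed (use u in auto)
  moreover have "- 2 * (fps_const c)\<^sup>2 - fps_const q = fps_const (- 2 * c\<^sup>2 - q)"
    by (simp add: fps_const_power numeral_fps_const)
  ultimately show ?thesis
    by (simp add: quadratic_fps_def fps_const_power)
qed

text \<open>Here \<open>p\<close> is the \<open>c\<close> of the preceding level, and
  \<open>M - u - c\<^sup>2\<close> stands for the \<open>u\<close> of the next one.
  \<open>K\<close>, \<open>M\<close>, \<open>L\<close> are the quantities conserved along the
  continued fraction.\<close>

definition cfrac_inv :: "'a::field \<Rightarrow> 'a \<Rightarrow> 'a \<Rightarrow> 'a \<Rightarrow> 'a \<Rightarrow> 'a \<Rightarrow> 'a fps \<Rightarrow> bool" where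
  "cfrac_inv K M L p u c G \<longleftrightarrow> quadratic_fps 1 p (2 * u - M) u (u * c) G \<and>
     u * (c + p) = K \<and> u * (M - u - c\<^sup>2) + K * c = L"

lemma cfrac_inv_step:
  assumes inv: "cfrac_inv K M L p u c G" and u: "u \<noteq> 0"
    and u': "fps_nth (cfrac_tail G) 0 \<noteq> 0"
  defines "w \<equiv> M - u - c\<^sup>2"
  shows "\<exists>c'. cfrac_inv K M L c w c' (cfrac_tail G)"
proof -
  let ?q = "2 * u - M"
  have "quadratic_fps 1 c (- 2 * c\<^sup>2 - ?q) (u * 1 - (c\<^sup>2 + ?q)) (u * p + (c\<^sup>2 + ?q) * c) (cfrac_tail G)"
    using inv u by (intro quadratic_fps_cfrac_tail) (auto simp: cfrac_inv_def)
  moreover have "- 2 * c\<^sup>2 - ?q = 2 * w - M" "u * 1 - (c\<^sup>2 + ?q) = w"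
    by (simp_all add: w_def)
  ultimately have q: "quadratic_fps 1 c (2 * w - M) w (u * p + (c\<^sup>2 + ?q) * c) (cfrac_tail G)"
    by metis
  then have w: "w \<noteq> 0"
    using u' quadratic_fps_nth by metis
  define c' where "c' = (u * p + (c\<^sup>2 + ?q) * c) / w"
  have wc': "w * c' = u * p + (c\<^sup>2 + ?q) * c"
    using w by (simp add: c'_def)
  have K: "w * (c' + c) = K"
  proof -
    have "w * (c' + c) = u * (c + p)"
      unfolding distrib_left wc' by (simp add: w_def algebra_simps)
    then show ?thesis using inv by (simp add: cfrac_inv_def)
  qed
  \<comment> \<open>After substituting \<open>K = w * (c' + c)\<close>, both sides equal
    \<open>w * (M - w + c * c')\<close>, which is symmetric in \<open>c\<close> and
    \<open>c'\<close>. Also \<open>M - w - c\<^sup>2 = u\<close>.\<close>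
  have "w * (M - w - c'\<^sup>2) + K * c' = w * (M - w - c\<^sup>2) + K * c"
    unfolding K[symmetric] by (simp add: algebra_simps power2_eq_square)
  also have "\<dots> = L"
    using inv by (simp add: cfrac_inv_def w_def mult.commute)
  finally show ?thesis
    using q[folded wc'] K by (intro exI[of _ c']) (simp add: cfrac_inv_def)
qed

section \<open>The recurrence over a field\<close>

definition conv_rec :: "'a::comm_ring_1 \<Rightarrow> 'a \<Rightarrow> 'a \<Rightarrow> (nat \<Rightarrow> 'a) \<Rightarrow> bool" where
  "conv_rec a b g s \<longleftrightarrow> (\<forall>j\<ge>2. s j = a * s (j - 2)
     + b * (\<Sum>i\<in>{i. i + 2 \<le> j}. s i * s (j - 2 - i))
     + g * (\<Sum>i\<in>{i. i + 3 \<le> j}. s i * s (j - 3 - i)))"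

lemma conv_rec_quadratic_fps:
  assumes "conv_rec a b g s"
  shows "quadratic_fps b g (- a) (s 0) (s 1) (Abs_fps s)"
proof -
  let ?G = "Abs_fps s"
  have conv: "(\<Sum>i\<in>{i. i + k \<le> j}. s i * s (j - k - i)) = fps_nth (?G\<^sup>2) (j - k)" if "k \<le> j" for j k
  proof -
    have "{i. i + k \<le> j} = {0..j - k}" using that by auto
    then show ?thesis by (simp add: power2_eq_square fps_mult_nth)
  qed
  have s_rec: "s j = a * s (j - 2) + b * fps_nth (?G\<^sup>2) (j - 2)
    + g * (if j < 3 then 0 else fps_nth (?G\<^sup>2) (j - 3))" if "j \<ge> 2" for j
  proof -
    have rec_j: "s j = a * s (j - 2) + b * (\<Sum>i\<in>{i. i + 2 \<le> j}. s i * s (j - 2 - i))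
        + g * (\<Sum>i\<in>{i. i + 3 \<le> j}. s i * s (j - 3 - i))"
      using assms that unfolding conv_rec_def by blast
    \<comment> \<open>At \<open>j = 2\<close> the sum is empty, while \<open>j - 3\<close> truncates
      to 0; hence the case distinction.\<close>
    have "(\<Sum>i\<in>{i. i + 3 \<le> j}. s i * s (j - 3 - i)) = (if j < 3 then 0 else fps_nth (?G\<^sup>2) (j - 3))"
      using conv[of 3 j] by auto
    then show ?thesis
      by (subst rec_j) (simp only: conv[OF that])
  qed
  have "?G = fps_const (s 0) + fps_const (s 1) * fps_X + fps_const a * (fps_X\<^sup>2 * ?G)
    + fps_const b * (fps_X\<^sup>2 * ?G\<^sup>2) + fps_const g * (fps_X ^ 3 * ?G\<^sup>2)" (is "_ = ?R")
  proof (rule fps_ext)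
    fix j :: nat
    consider "j = 0" | "j = 1" | "j \<ge> 2" by linarith
    then show "fps_nth ?G j = fps_nth ?R j"
    proof cases
      case 3
      have "fps_nth ?R j = a * s (j - 2) + b * fps_nth (?G\<^sup>2) (j - 2)
        + g * (if j < 3 then 0 else fps_nth (?G\<^sup>2) (j - 3))"
        using 3 by (simp add: fps_X_power_mult_nth)
      then show ?thesis
        using s_rec[OF 3] by simp
    qed (simp_all add: fps_X_power_mult_nth)
  qed
  then have "?R - ?G = 0"
    by (metis eq_iff_diff_eq_0)
  moreover have "fps_X\<^sup>2 * (fps_const b + fps_const g * fps_X) * ?G\<^sup>2
      - (1 + fps_const (- a) * fps_X\<^sup>2) * ?G + (fps_const (s 0) + fps_const (s 1) * fps_X) = ?R - ?G"
    by (simp add: algebra_simps power2_eq_square power3_eq_cube flip: fps_const_neg)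
  ultimately show ?thesis
    by (simp only: quadratic_fps_def)
qed

lemma hankel_det_1: "hankel_det s 1 = s 0"
  by (simp add: hankel_det_def det_single)

section \<open>Somos-4 and its first integral from the relations between \<open>u\<close> and
  \<open>c\<close>\<close>

definition somos4_with_integral :: "'a::comm_ring_1 \<Rightarrow> 'a \<Rightarrow> 'a \<Rightarrow> (nat \<Rightarrow> 'a) \<Rightarrow> bool" where
  "somos4_with_integral \<alpha> \<beta> J X \<longleftrightarrow>
    (\<forall>n. X (n + 4) * X n = \<alpha> * X (n + 3) * X (n + 1) + \<beta> * (X (n + 2))\<^sup>2) \<and>
    (\<forall>n. (X n)\<^sup>2 * (X (n + 3))\<^sup>2 + \<alpha> * (X (n + 1) ^ 3 * X (n + 3) + X n * X (n + 2) ^ 3)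
        + \<beta> * (X (n + 1))\<^sup>2 * (X (n + 2))\<^sup>2
      = J * (X n * X (n + 1) * X (n + 2) * X (n + 3)))"

text \<open>\<open>Du\<close> turns both claims into identities in \<open>u\<close> alone, once
  powers of \<open>D\<close> are cancelled: a second-order recurrence (\<open>u\<close>) and a
  biquadratic relation (\<open>bi\<close>).\<close>

lemma somos4_with_integralI:
  fixes D u c :: "nat \<Rightarrow> 'a::field"
  assumes D: "\<And>n. D n \<noteq> 0"
    and Du: "\<And>n. D (n + 2) * D n = u n * (D (n + 1))\<^sup>2"
    and K: "\<And>n. u (Suc n) * (c (Suc n) + c n) = K"
    and M: "\<And>n. u (Suc n) + u n + (c n)\<^sup>2 = M"
    and L: "\<And>n. u n * u (Suc n) + K * c n = L"
  shows "somos4_with_integral (K\<^sup>2) (L\<^sup>2 - K\<^sup>2 * M) (2 * L) D"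
  unfolding somos4_with_integral_def
proof (intro conjI allI)
  fix n
  let ?D0 = "D n" and ?D1 = "D (n + 1)" and ?D2 = "D (n + 2)" and ?D3 = "D (n + 3)" and ?D4 = "D (n + 4)"
  have Du0: "?D2 * ?D0 = u n * ?D1\<^sup>2" and Du1: "?D3 * ?D1 = u (n + 1) * ?D2\<^sup>2"
    and Du2: "?D4 * ?D2 = u (n + 2) * ?D3\<^sup>2"
    using Du[of n] Du[of "n + 1"] Du[of "n + 2"] by (simp_all add: numeral_eq_Suc)
  have K': "u (n + 1) * (c (n + 1) + c n) = K" using K[of n] by simp
  have M1: "u (n + 1) + u n + (c n)\<^sup>2 = M" and M2: "u (n + 2) + u (n + 1) + (c (n + 1))\<^sup>2 = M"
    using M[of n] M[of "n + 1"] by simp_all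
  have L1: "u n * u (n + 1) = L - K * c n" and L2: "u (n + 1) * u (n + 2) = L - K * c (n + 1)"
    using L[of n] L[of "n + 1"] by (simp_all add: eq_diff_eq)
  have D12: "?D1 \<noteq> 0" "?D2 \<noteq> 0" using D by auto
  have u: "u (n + 2) * (u (n + 1))\<^sup>2 * u n = K\<^sup>2 * u (n + 1) + (L\<^sup>2 - K\<^sup>2 * M)"
  proof -
    have "u (n + 2) * (u (n + 1))\<^sup>2 * u n = (u (n + 1) * u (n + 2)) * (u n * u (n + 1))"
      by (simp add: power2_eq_square mult_ac)
    also have "\<dots> = L\<^sup>2 - K * (c (n + 1) + c n) * L + K\<^sup>2 * c n * c (n + 1)"
      unfolding L1 L2 by (simp add: power2_eq_square algebra_simps)
    \<comment> \<open>Expanding \<open>L\<close> again makes \<open>u (n + 1)\<close> meet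
      \<open>c (n + 1) + c n\<close>, so that \<open>K'\<close> applies.\<close>
    also have "L = u (n + 1) * u (n + 2) + K * c (n + 1)"
      unfolding L2 by simp
    also have "(u (n + 1) * u (n + 2) + K * c (n + 1))\<^sup>2
        - K * (c (n + 1) + c n) * (u (n + 1) * u (n + 2) + K * c (n + 1)) + K\<^sup>2 * c n * c (n + 1)
      = (u (n + 1) * u (n + 2) + K * c (n + 1))\<^sup>2
        - K * u (n + 2) * (u (n + 1) * (c (n + 1) + c n)) - K\<^sup>2 * (c (n + 1))\<^sup>2"
      by (simp add: power2_eq_square algebra_simps)
    also have "\<dots> = K\<^sup>2 * u (n + 1) + (L\<^sup>2 - K\<^sup>2 * M)"
      unfolding K' L2 unfolding M2[symmetric] by (simp add: power2_eq_square algebra_simps)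
    finally show ?thesis .
  qed
  have "?D4 * ?D0 * ?D2\<^sup>2 = (u (n + 2) * u n) * (?D3 * ?D1)\<^sup>2"
    unfolding power_mult_distrib using arg_cong2[OF Du0 Du2, of "(*)"]
    by (simp add: power2_eq_square mult_ac)
  also have "\<dots> = (u (n + 2) * (u (n + 1))\<^sup>2 * u n) * ?D2\<^sup>2 * ?D2\<^sup>2"
    unfolding Du1 by (simp add: power2_eq_square mult_ac)
  also have "\<dots> = (K\<^sup>2 * (u (n + 1) * ?D2\<^sup>2) + (L\<^sup>2 - K\<^sup>2 * M) * ?D2\<^sup>2) * ?D2\<^sup>2"
    unfolding u by (simp add: power2_eq_square algebra_simps)
  finally have "?D4 * ?D0 = K\<^sup>2 * (u (n + 1) * ?D2\<^sup>2) + (L\<^sup>2 - K\<^sup>2 * M) * ?D2\<^sup>2"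
    using D12 by simp
  then show "?D4 * ?D0 = K\<^sup>2 * ?D3 * ?D1 + (L\<^sup>2 - K\<^sup>2 * M) * ?D2\<^sup>2"
    by (simp only: Du1[symmetric] mult.assoc)
  \<comment> \<open>This is \<open>(u n * u (n + 1) - L)\<^sup>2 = K\<^sup>2 * (c n)\<^sup>2\<close>
    with \<open>(c n)\<^sup>2\<close> eliminated by \<open>M1\<close>.\<close>
  have bi: "(u n * u (n + 1))\<^sup>2 + K\<^sup>2 * (u n + u (n + 1)) + (L\<^sup>2 - K\<^sup>2 * M) = 2 * L * (u n * u (n + 1))"
    unfolding L1 unfolding M1[symmetric] by (simp add: power2_eq_square algebra_simps)
  have "(?D0 * ?D3) * (?D1 * ?D2) = (u n * u (n + 1) * ?D1 * ?D2) * (?D1 * ?D2)"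
    using arg_cong2[OF Du0 Du1, of "(*)"] by (simp add: power2_eq_square mult_ac)
  then have D03: "?D0 * ?D3 = u n * u (n + 1) * ?D1 * ?D2"
    using D12 by simp
  have "?D0\<^sup>2 * ?D3\<^sup>2 + K\<^sup>2 * (?D1 ^ 3 * ?D3 + ?D0 * ?D2 ^ 3) + (L\<^sup>2 - K\<^sup>2 * M) * ?D1\<^sup>2 * ?D2\<^sup>2
    = (?D0 * ?D3)\<^sup>2 + K\<^sup>2 * (?D1\<^sup>2 * (?D3 * ?D1) + (?D2 * ?D0) * ?D2\<^sup>2)
      + (L\<^sup>2 - K\<^sup>2 * M) * (?D1\<^sup>2 * ?D2\<^sup>2)"
    by (simp add: power2_eq_square power3_eq_cube algebra_simps)
  also have "\<dots> = ((u n * u (n + 1))\<^sup>2 + K\<^sup>2 * (u n + u (n + 1)) + (L\<^sup>2 - K\<^sup>2 * M)) * (?D1\<^sup>2 * ?D2\<^sup>2)"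
    unfolding D03 Du0 Du1 by (simp add: power2_eq_square algebra_simps)
  also have "\<dots> = 2 * L * ((?D0 * ?D3) * ?D1 * ?D2)"
    unfolding bi D03 by (simp add: power2_eq_square algebra_simps)
  finally show "?D0\<^sup>2 * ?D3\<^sup>2 + K\<^sup>2 * (?D1 ^ 3 * ?D3 + ?D0 * ?D2 ^ 3) + (L\<^sup>2 - K\<^sup>2 * M) * ?D1\<^sup>2 * ?D2\<^sup>2
    = 2 * L * (?D0 * ?D1 * ?D2 * ?D3)"
    by (simp add: mult_ac)
qed

lemma conv_rec_hankel_det_somos4_field:
  fixes s :: "nat \<Rightarrow> 'a::field"
  assumes rec: "conv_rec a b g s" and nz: "\<And>n. hankel_det s n \<noteq> 0"
  defines "K \<equiv> s 0 * g + s 1 * b" and "M \<equiv> a + 2 * s 0 * b"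
    and "L \<equiv> s 0 * a * b + (s 0)\<^sup>2 * b\<^sup>2 + s 1 * g"
  shows "somos4_with_integral (K\<^sup>2) (L\<^sup>2 - K\<^sup>2 * M) (2 * L) (hankel_det s)"
proof -
  define Gs where "Gs k = (cfrac_tail ^^ k) (Abs_fps s)" for k
  define u where "u k = fps_nth (Gs k) 0" for k
  define c where "c k = fps_nth (Gs k) 1 / fps_nth (Gs k) 0" for k
  have nth_s: "fps_nth (Abs_fps s) = s"
    by (rule ext) simp
  have Gs_0: "Gs 0 = Abs_fps s" and Gs_Suc: "Gs (Suc k) = cfrac_tail (Gs k)" for k
    by (simp_all add: Gs_def)
  have u_hankel: "u k = hankel_det (fps_nth (Gs k)) 1" for k
    by (simp only: u_def hankel_det_1)
  have step: "hankel_det (fps_nth (Gs k)) (Suc n) = u k ^ Suc n * hankel_det (fps_nth (Gs (Suc k))) n"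
    if "u k \<noteq> 0" for k n
    using hankel_det_cfrac_step[OF cfrac_tail[OF that[unfolded u_def]]] unfolding u_def Gs_Suc .
  \<comment> \<open>The 1 by 1 determinant at level \<open>k\<close> is \<open>u k\<close>, so the
    expansion never breaks off, and \<open>step\<close> carries nonvanishing to the next
    level.\<close>
  have nzk: "hankel_det (fps_nth (Gs k)) n \<noteq> 0" for k n
  proof (induction k arbitrary: n)
    case 0
    show ?case using nz by (simp add: Gs_0)
  next
    case (Suc k)
    from Suc.IH[of 1] have "u k \<noteq> 0" by (simp only: u_hankel not_False_eq_True)
    with Suc.IH[of "Suc n"] step[of k n] show ?case by auto
  qed
  have u: "u k \<noteq> 0" for k
    using nzk[of k 1] by (simp only: u_hankel not_False_eq_True)
  \<comment> \<open>One \<open>step\<close> on each determinant lowers the size and raises the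
    level; \<open>u k\<close> occurs to the power \<open>2 * n + 4\<close> on both sides and drops
    out.\<close>
  have Du: "hankel_det (fps_nth (Gs k)) (n + 2) * hankel_det (fps_nth (Gs k)) n
    = u (k + n + 1) * (hankel_det (fps_nth (Gs k)) (n + 1))\<^sup>2" for k n
  proof (induction n arbitrary: k)
    case 0
    show ?case
      using step[OF u, of k 0] step[OF u, of k 1]
      by (simp add: u_hankel[symmetric, unfolded One_nat_def] hankel_det_0 numeral_eq_Suc algebra_simps)
  next
    case (Suc n)
    show ?case
      using Suc.IH[of "Suc k"] step[OF u, of k n] step[OF u, of k "n + 1"] step[OF u, of k "n + 2"]
      by (simp add: power2_eq_square algebra_simps)
  qed
  \<comment> \<open>Index shift: the ratio of determinants around \<open>n + 1\<close> is
    \<open>u (n + 1)\<close>, and the invariant holds only from the first tail on.\<close>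
  define v where "v k = u (Suc k)" for k
  define e where "e k = c (Suc k)" for k
  have q0: "quadratic_fps b g (- a) (s 0) (s 1) (Gs 0)"
    using conv_rec_quadratic_fps[OF rec] by (simp add: Gs_0)
  have s0: "s 0 = u 0" "s 1 = u 0 * c 0"
    using quadratic_fps_nth[OF q0] u[of 0] by (simp_all add: u_def c_def)
  \<comment> \<open>The first step is separate, since the leading part of the initial equation is
    \<open>b + g x\<close> rather than \<open>1 + p x\<close>.\<close>
  have q1: "quadratic_fps 1 (c 0) (- 2 * (c 0)\<^sup>2 - - a) (s 0 * b - ((c 0)\<^sup>2 + - a))
      (s 0 * g + ((c 0)\<^sup>2 + - a) * c 0) (Gs (Suc 0))"
    unfolding Gs_Suc using quadratic_fps_cfrac_tail[OF q0] s0 u[of 0] by simp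
  have next_inv: "cfrac_inv K M L (c (Suc k)) (u (Suc (Suc k))) (c (Suc (Suc k))) (Gs (Suc (Suc k)))
      \<and> u (Suc (Suc k)) = M - u (Suc k) - (c (Suc k))\<^sup>2"
    if prev: "cfrac_inv K M L (c k) (u (Suc k)) (c (Suc k)) (Gs (Suc k))" for k
  proof -
    obtain c' where c': "cfrac_inv K M L (c (Suc k)) (M - u (Suc k) - (c (Suc k))\<^sup>2) c' (Gs (Suc (Suc k)))"
      using cfrac_inv_step[OF prev] u[of "Suc k"] u[of "Suc (Suc k)"] by (auto simp: u_def Gs_Suc)
    then have "fps_nth (Gs (Suc (Suc k))) 0 = M - u (Suc k) - (c (Suc k))\<^sup>2"
      and "fps_nth (Gs (Suc (Suc k))) 1 = (M - u (Suc k) - (c (Suc k))\<^sup>2) * c'"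
      unfolding cfrac_inv_def using quadratic_fps_nth by blast+
    with u[of "Suc (Suc k)"] have "u (Suc (Suc k)) = M - u (Suc k) - (c (Suc k))\<^sup>2" "c (Suc (Suc k)) = c'"
      by (auto simp: u_def c_def)
    with c' show ?thesis by simp
  qed
  have inv: "cfrac_inv K M L (c k) (u (Suc k)) (c (Suc k)) (Gs (Suc k))" for k
  proof (induction k)
    case 0
    \<comment> \<open>The values of \<open>K\<close>, \<open>M\<close>, \<open>L\<close> in terms of
      the parameters are read off from this first tail.\<close>
    have u1: "u 1 = s 0 * b - ((c 0)\<^sup>2 + - a)" and uc1: "u 1 * c 1 = s 0 * g + ((c 0)\<^sup>2 + - a) * c 0"
      using quadratic_fps_nth[OF q1] u[of 1] by (simp_all add: u_def c_def)
    have q: "- 2 * (c 0)\<^sup>2 - - a = 2 * u 1 - M"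
      unfolding u1 M_def by (simp add: algebra_simps)
    have K: "u 1 * (c 1 + c 0) = K"
      unfolding distrib_left uc1 unfolding u1 K_def s0 by (simp add: algebra_simps)
    have "u 1 * (M - u 1 - (c 1)\<^sup>2) + K * c 1 = u 1 * (M - u 1 - (c 0)\<^sup>2) + K * c 0"
      unfolding K[symmetric] by (simp add: algebra_simps power2_eq_square)
    also have "\<dots> = L"
      unfolding u1 K_def M_def L_def s0 by (simp add: algebra_simps power2_eq_square)
    finally show ?case
      using q1[folded uc1 u1, unfolded q] K by (simp add: cfrac_inv_def)
  qed (use next_inv in blast)
  show ?thesis
  proof (rule somos4_with_integralI[where u = v and c = e])
    fix n
    have inv': "u (Suc (Suc n)) * (c (Suc (Suc n)) + c (Suc n)) = K"
      "u (Suc n) * (M - u (Suc n) - (c (Suc n))\<^sup>2) + K * c (Suc n) = L"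
      using inv[of n] inv[of "Suc n"] by (simp_all add: cfrac_inv_def)
    have u_next: "u (Suc (Suc n)) = M - u (Suc n) - (c (Suc n))\<^sup>2"
      using next_inv[OF inv] by blast
    show "hankel_det s n \<noteq> 0" by (rule nz)
    show "hankel_det s (n + 2) * hankel_det s n = v n * (hankel_det s (n + 1))\<^sup>2"
      using Du[of 0 n] unfolding Gs_0 nth_s v_def by simp
    show "v (Suc n) * (e (Suc n) + e n) = K"
      using inv'(1) by (simp add: v_def e_def)
    show "v (Suc n) + v n + (e n)\<^sup>2 = M"
      by (simp add: v_def e_def u_next)
    show "v n * v (Suc n) + K * e n = L"
      using inv'(2) by (simp add: v_def e_def u_next)
  qed
qed

section \<open>Transfer to the dual numbers\<close>

lemma conv_rec_hom:
  assumes "comm_ring_hom h" and "conv_rec a b g s"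
  shows "conv_rec (h a) (h b) (h g) (\<lambda>n. h (s n))"
proof -
  interpret comm_ring_hom h by fact
  show ?thesis
    using assms(2) unfolding conv_rec_def by (simp add: hom_distribs)
qed

lemma hankel_det_hom:
  assumes "comm_ring_hom h"
  shows "hankel_det (\<lambda>n. h (s n)) n = h (hankel_det s n)"
proof -
  interpret comm_ring_hom h by fact
  have "mat n n (\<lambda>(i, j). h (s (i + j))) = map_mat h (mat n n (\<lambda>(i, j). s (i + j)))"
    by (rule eq_matI) auto
  then show ?thesis
    by (simp add: hankel_det_def)
qed

lemma somos4_with_integral_hom:
  assumes "comm_ring_hom h" and "somos4_with_integral \<alpha> \<beta> J X"
  shows "somos4_with_integral (h \<alpha>) (h \<beta>) (h J) (\<lambda>n. h (X n))"
proof -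
  interpret comm_ring_hom h by fact
  show ?thesis
    using assms(2) unfolding somos4_with_integral_def hom_distribs[symmetric] by metis
qed

lemma somos4_with_integral_inj_hom:
  assumes "comm_ring_hom h" and "inj h"
    and "somos4_with_integral (h \<alpha>) (h \<beta>) (h J) (\<lambda>n. h (X n))"
  shows "somos4_with_integral \<alpha> \<beta> J X"
proof -
  interpret comm_ring_hom h by fact
  show ?thesis
    using assms(3) unfolding somos4_with_integral_def hom_distribs[symmetric] inj_eq[OF assms(2)] .
qed

section \<open>Existence and uniqueness for the recursion over any commutative ring\<close>

fun conv_seq :: "'a::comm_ring_1 \<Rightarrow> 'a \<Rightarrow> 'a \<Rightarrow> 'a \<Rightarrow> 'a \<Rightarrow> nat \<Rightarrow> 'a" where
  "conv_seq a b g s0 s1 j = (if j = 0 then s0 else if j = 1 then s1 else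
     a * conv_seq a b g s0 s1 (j - 2)
     + b * (\<Sum>i\<in>{i. i + 2 \<le> j}. conv_seq a b g s0 s1 i * conv_seq a b g s0 s1 (j - 2 - i))
     + g * (\<Sum>i\<in>{i. i + 3 \<le> j}. conv_seq a b g s0 s1 i * conv_seq a b g s0 s1 (j - 3 - i)))"

declare conv_seq.simps [simp del]

lemma conv_rec_conv_seq: "conv_rec a b g (conv_seq a b g s0 s1)"
  unfolding conv_rec_def
proof (intro allI impI)
  fix j :: nat assume "2 \<le> j"
  then show "conv_seq a b g s0 s1 j = a * conv_seq a b g s0 s1 (j - 2)
     + b * (\<Sum>i\<in>{i. i + 2 \<le> j}. conv_seq a b g s0 s1 i * conv_seq a b g s0 s1 (j - 2 - i))
     + g * (\<Sum>i\<in>{i. i + 3 \<le> j}. conv_seq a b g s0 s1 i * conv_seq a b g s0 s1 (j - 3 - i))"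
    by (subst conv_seq.simps) simp
qed

lemma conv_seq_init [simp]:
  "conv_seq a b g s0 s1 0 = s0" "conv_seq a b g s0 s1 (Suc 0) = s1"
  by (simp_all add: conv_seq.simps)

text \<open>Serves to identify the given dual sequence with the image of its polynomial
  lift.\<close>

lemma conv_rec_unique:
  assumes s: "conv_rec a b g s" and t: "conv_rec a b g t"
    and "s 0 = t 0" and "s 1 = t 1"
  shows "s = t"
proof
  fix j
  show "s j = t j"
  proof (induction j rule: less_induct)
    case (less j)
    consider "j = 0" | "j = 1" | "j \<ge> 2" by linarith
    then show ?case
    proof cases
      case 3
      have "s j = a * s (j - 2)
          + b * (\<Sum>i\<in>{i. i + 2 \<le> j}. s i * s (j - 2 - i))
          + g * (\<Sum>i\<in>{i. i + 3 \<le> j}. s i * s (j - 3 - i))"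
        using s 3 unfolding conv_rec_def by blast
      also have "\<dots> = a * t (j - 2)
          + b * (\<Sum>i\<in>{i. i + 2 \<le> j}. t i * t (j - 2 - i))
          + g * (\<Sum>i\<in>{i. i + 3 \<le> j}. t i * t (j - 3 - i))"
        using 3 by (intro arg_cong2[of _ _ _ _ "(+)"] arg_cong2[of _ _ _ _ "(*)"] sum.cong refl less) auto
      also have "\<dots> = t j"
        by (rule sym) (use t 3 in \<open>unfold conv_rec_def, blast\<close>)
      finally show ?thesis .
    qed (use assms in simp_all)
  qed
qed

section \<open>From fields to integral domains and dual numbers\<close>

lemma conv_rec_hankel_det_somos4_idom:
  fixes s :: "nat \<Rightarrow> 'a::idom"
  assumes "conv_rec a b g s" and "\<And>n. hankel_det s n \<noteq> 0"
  shows "somos4_with_integral ((s 0 * g + s 1 * b)\<^sup>2)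
    ((s 0 * a * b + (s 0)\<^sup>2 * b\<^sup>2 + s 1 * g)\<^sup>2 - (s 0 * g + s 1 * b)\<^sup>2 * (a + 2 * s 0 * b))
    (2 * (s 0 * a * b + (s 0)\<^sup>2 * b\<^sup>2 + s 1 * g)) (hankel_det s)"
proof (rule somos4_with_integral_inj_hom)
  show h: "comm_ring_hom (to_fract :: 'a \<Rightarrow> 'a fract)"
    by unfold_locales simp_all
  interpret comm_ring_hom "to_fract :: 'a \<Rightarrow> 'a fract" by fact
  show "inj (to_fract :: 'a \<Rightarrow> 'a fract)"
    by (simp add: inj_on_def)
  \<comment> \<open>Injectivity of the embedding preserves nonvanishing here and brings the
    identities back afterwards.\<close>
  have "hankel_det (\<lambda>n. to_fract (s n)) n \<noteq> 0" for n
    using assms(2) by (simp add: hankel_det_hom[OF h])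
  from conv_rec_hankel_det_somos4_field[OF conv_rec_hom[OF h assms(1)] this]
  show "somos4_with_integral (to_fract ((s 0 * g + s 1 * b)\<^sup>2))
    (to_fract ((s 0 * a * b + (s 0)\<^sup>2 * b\<^sup>2 + s 1 * g)\<^sup>2 - (s 0 * g + s 1 * b)\<^sup>2 * (a + 2 * s 0 * b)))
    (to_fract (2 * (s 0 * a * b + (s 0)\<^sup>2 * b\<^sup>2 + s 1 * g))) (\<lambda>n. to_fract (hankel_det s n))"
    unfolding hankel_det_hom[OF h, symmetric] by (simp add: hom_distribs)
qed

text \<open>The generating function satisfies \<open>G = 1 / (1 - x^2 G)\<close>: it is its own tail
  with \<open>u = 1\<close>, so a continued fraction step leaves the determinants unchanged.\<close>

lemma hankel_det_catalan:
  fixes s :: "nat \<Rightarrow> 'a::field"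
  assumes "conv_rec 0 1 0 s" and "s 0 = 1" and "s 1 = 0"
  shows "hankel_det s n = 1"
proof (induction n)
  case (Suc n)
  let ?G = "Abs_fps s"
  have s: "fps_nth ?G = s" by (rule ext) simp
  have "?G * (1 - fps_const 0 * fps_X - fps_X\<^sup>2 * ?G) = fps_const 1"
    using conv_rec_quadratic_fps[OF assms(1)] assms(2,3)
    by (simp add: quadratic_fps_def algebra_simps power2_eq_square)
  from hankel_det_cfrac_step[OF this, of n] Suc show ?case
    unfolding s by simp
qed (rule hankel_det_0)

text \<open>Reduction modulo \<open>x^2\<close>, that is, evaluation of the polynomial at
  \<open>eps\<close>.\<close>

definition eval_eps :: "complex poly \<Rightarrow> dual" where
  "eval_eps p = Dual (coeff p 0) (coeff p 1)"

lemma comm_ring_hom_eval_eps: "comm_ring_hom eval_eps"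
  by unfold_locales
    (simp_all add: eval_eps_def zero_dual_def one_dual_def plus_dual_def times_dual_def
      coeff_mult algebra_simps)

lemma dual_lift: "\<exists>p. eval_eps p = z \<and> poly p 1 = w"
proof
  \<comment> \<open>The coefficient of \<open>x^2\<close> is invisible to \<open>eval_eps\<close>
    and is free to adjust the value at 1.\<close>
  show "eval_eps [:body z, soul z, w - body z - soul z:] = z \<and>
    poly [:body z, soul z, w - body z - soul z:] 1 = w"
    by (simp add: eval_eps_def)
qed

lemma conv_rec_hankel_det_somos4_dual:
  fixes s :: "nat \<Rightarrow> dual"
  assumes "conv_rec a b g s"
  shows "somos4_with_integral ((s 0 * g + s 1 * b)\<^sup>2)
    ((s 0 * a * b + (s 0)\<^sup>2 * b\<^sup>2 + s 1 * g)\<^sup>2 - (s 0 * g + s 1 * b)\<^sup>2 * (a + 2 * s 0 * b))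
    (2 * (s 0 * a * b + (s 0)\<^sup>2 * b\<^sup>2 + s 1 * g)) (hankel_det s)"
proof -
  obtain A B C S0 S1 where lift:
    "eval_eps A = a" "eval_eps B = b" "eval_eps C = g" "eval_eps S0 = s 0" "eval_eps S1 = s 1"
    and at_1: "poly A 1 = 0" "poly B 1 = 1" "poly C 1 = 0" "poly S0 1 = 1" "poly S1 1 = 0"
    using dual_lift by meson
  interpret comm_ring_hom eval_eps by (rule comm_ring_hom_eval_eps)
  have ev: "comm_ring_hom (\<lambda>p :: complex poly. poly p 1)"
    by unfold_locales simp_all
  define S where "S = conv_seq A B C S0 S1"
  have S: "conv_rec A B C S" and S_init: "S 0 = S0" "S 1 = S1"
    by (simp_all add: S_def conv_rec_conv_seq)
  have s: "s = (\<lambda>n. eval_eps (S n))"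
    by (rule conv_rec_unique[OF assms])
      (use conv_rec_hom[OF comm_ring_hom_eval_eps S] lift S_init in simp_all)
  \<comment> \<open>Evaluation at 1 sends \<open>S\<close> to the aerated Catalan numbers by the
    choice in \<open>at_1\<close>, so each determinant is a polynomial with value 1 there.\<close>
  have "hankel_det S n \<noteq> 0" for n
  proof
    assume "hankel_det S n = 0"
    then have "hankel_det (\<lambda>n. poly (S n) 1) n = 0"
      by (simp add: hankel_det_hom[OF ev])
    moreover have "hankel_det (\<lambda>n. poly (S n) 1) n = 1"
      by (rule hankel_det_catalan) (use conv_rec_hom[OF ev S] at_1 S_init in simp_all)
    ultimately show False by simp
  qed
  from somos4_with_integral_hom[OF comm_ring_hom_eval_eps conv_rec_hankel_det_somos4_idom[OF S this]]
  show ?thesis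
    unfolding hankel_det_hom[OF comm_ring_hom_eval_eps, symmetric] s[symmetric]
    by (simp add: hom_distribs S_init lift del: One_nat_def)
qed

theorem theorem4p1:
  fixes \<alpha>' \<beta>' \<gamma>' \<alpha> \<beta> U F J :: dual
    and s X :: "nat \<Rightarrow> dual"
  assumes "\<alpha>' \<in> dual_units" and "\<beta>' \<in> dual_units" and "\<gamma>' \<in> dual_units"
    and "s 0 \<in> dual_units"
    and "\<And>j. j \<ge> 2 \<Longrightarrow>
      s j = \<alpha>' * s (j - 2) + \<beta>' * (\<Sum>i\<in>{i. i + 2 \<le> j}. s i * s (j - 2 - i))
        + \<gamma>' * (\<Sum>i\<in>{i. i + 3 \<le> j}. s i * s (j - 3 - i))"
    and "\<And>n. n \<ge> 1 \<Longrightarrow> X n = hankel_det s (n - 1)"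
    and "U = - s 0 * \<gamma>' - s 1 * \<beta>'"
    and "F = - \<alpha>' - 2 * s 0 * \<beta>'"
    and "J = 2 * (s 0 * \<alpha>' * \<beta>' + (s 0)\<^sup>2 * \<beta>'\<^sup>2 + s 1 * \<gamma>')"
    and "\<alpha> = U\<^sup>2"
    and "\<beta> = \<alpha> * F + dual_of_complex (1 / 4) * J\<^sup>2"
  shows "(\<forall>n\<ge>1. X (n + 4) * X n = \<alpha> * X (n + 3) * X (n + 1) + \<beta> * (X (n + 2))\<^sup>2) \<and>
    (\<forall>n\<ge>1. (X n)\<^sup>2 * (X (n + 3))\<^sup>2
        + \<alpha> * (X (n + 1) ^ 3 * X (n + 3) + X n * X (n + 2) ^ 3)
        + \<beta> * (X (n + 1))\<^sup>2 * (X (n + 2))\<^sup>2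
      = J * (X n * X (n + 1) * X (n + 2) * X (n + 3)))"
proof -
  \<comment> \<open>In these terms \<open>U = - K\<close>, \<open>F = - M\<close> and
    \<open>J = 2 * L\<close>.\<close>
  define K M L where "K = s 0 * \<gamma>' + s 1 * \<beta>'" and "M = \<alpha>' + 2 * s 0 * \<beta>'"
    and "L = s 0 * \<alpha>' * \<beta>' + (s 0)\<^sup>2 * \<beta>'\<^sup>2 + s 1 * \<gamma>'"
  have "conv_rec \<alpha>' \<beta>' \<gamma>' s"
    unfolding conv_rec_def using assms(5) by blast
  from conv_rec_hankel_det_somos4_dual[OF this]
  have somos: "somos4_with_integral (K\<^sup>2) (L\<^sup>2 - K\<^sup>2 * M) (2 * L) (hankel_det s)"
    by (simp only: K_def M_def L_def)
  have J: "J = 2 * L"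
    using assms(9) by (simp add: L_def)
  have \<alpha>: "\<alpha> = K\<^sup>2"
    unfolding assms(10) assms(7) K_def by (simp add: power2_eq_square algebra_simps)
  \<comment> \<open>The ring numeral 4 is matched with the embedded complex 4, so that the scalar
    1/4 cancels the 4 in \<open>J\<^sup>2\<close>.\<close>
  have "(4 :: dual) = 1 + 1 + 1 + 1"
    by simp
  also have "\<dots> = Dual 4 0"
    unfolding one_dual_def plus_dual_def by simp
  finally have four: "(4 :: dual) = Dual 4 0" .
  have quarter: "dual_of_complex (1 / 4) * 4 = 1"
    unfolding four dual_of_complex_def one_dual_def times_dual_def by simp
  have "dual_of_complex (1 / 4) * J\<^sup>2 = dual_of_complex (1 / 4) * 4 * L\<^sup>2"
    unfolding J by (simp add: power_mult_distrib mult.assoc)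
  then have \<beta>: "\<beta> = L\<^sup>2 - K\<^sup>2 * M"
    unfolding assms(11) \<alpha> assms(8) quarter by (simp add: M_def algebra_simps)
  \<comment> \<open>\<open>X\<close> starts at index 1 and the determinants at size 0, so the
    statement for \<open>n = Suc m\<close> is the one for \<open>hankel_det s\<close> at
    \<open>m\<close>.\<close>
  have X: "X (Suc n) = hankel_det s n" for n
    using assms(6)[of "Suc n"] by simp
  show ?thesis
  proof (intro conjI allI impI)
    fix n :: nat assume "n \<ge> 1"
    then obtain m where n: "n = Suc m" by (cases n) auto
    show "X (n + 4) * X n = \<alpha> * X (n + 3) * X (n + 1) + \<beta> * (X (n + 2))\<^sup>2"
      "(X n)\<^sup>2 * (X (n + 3))\<^sup>2 + \<alpha> * (X (n + 1) ^ 3 * X (n + 3) + X n * X (n + 2) ^ 3)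
        + \<beta> * (X (n + 1))\<^sup>2 * (X (n + 2))\<^sup>2 = J * (X n * X (n + 1) * X (n + 2) * X (n + 3))"
      using somos unfolding somos4_with_integral_def n add_Suc X \<alpha> \<beta> J by blast+
  qed
qed

end
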